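(* Let $\{P_n(x)\}_{n\ge 1}$ and the coefficients $b_i(n)$ be as defined in the context, $m=\lfloor\frac{n-1}{2}\rfloor$. For $n\ge1$, $b_0(n)=n(\frac{n-1}{2})!$ if $n$ is odd and $b_0(n)=(\frac n2)!$ if $n$ is even. For $n\ge3$, $b_1(n)=\frac16 n(5n-7)(\frac{n-1}{2})!$ if $n$ is odd and $b_1(n)=\frac16(5n-8)(\frac n2)!$ if $n$ is even. More generally, for each fixed integer $i\ge0$ there are polynomials $Y_i$, $Z_i$ in $n$, each of degree $2i+1$, such that $b_i(n)=(m-i)!\,Y_i(n)$ for all odd $n$ with $m\ge i$ and $b_i(n)=(m-i)!\,Z_i(n)$ for all even $n$ with $m\ge i$.
   Context: The sequence $\{P_n(x)\}_{n\ge1}$ of rational functions of $x$ is defined by $P_1=P_2=1$ and, for $n\ge 2$: if $n$ is odd, $4(2x+n)P_{n+1}(x)=2(x+n)P_n(x)+(2x+n)P_n(x+1)+(4x+n)\ell_n(x)$; if $n$ is even, $4P_{n+1}(x)=4(x+n)P_n(x)+2(2x+n+1)P_n(x+1)+(4x+n)\ell_{n-1}(x)$. Here for odd $r\ge1$, $\ell_r(x)=\prod_{j=1}^{(r-1)/2}(x+j)$ (the empty product equals $1$). Each $P_n$ is a polynomial of degree $m=\lfloor\frac{n-1}{2}\rfloor$; its coefficients in the binomial basis are defined by $P_n(x)=\sum_{i=0}^{m}b_i(n)\binom{x}{m-i}$. *)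

theory Defs
  imports Complex_Main "HOL-Computational_Algebra.Computational_Algebra"
begin

text \<open>Rational functions in one variable \<open>x\<close> over the rationals are elements of
  \<^typ>\<open>rat poly fract\<close>; rational constants are embedded by \<^const>\<open>of_rat\<close>, natural
  numbers by \<^const>\<open>of_nat\<close>.\<close>

type_synonym ratfun = "rat poly fract"

definition X :: ratfun where
  "X = Fract [:0, 1:] 1"

text \<open>The substitution \<open>f(x) \<mapsto> f(x + 1)\<close>; by \<open>shift_Fract\<close> it does not depend on the
  representation of \<open>f\<close> as a quotient of polynomials.\<close>

definition shift :: "ratfun \<Rightarrow> ratfun" where
  "shift f = (THE g. \<exists>p q. q \<noteq> 0 \<and> f = Fract p q
     \<and> g = Fract (pcompose p [:1, 1:]) (pcompose q [:1, 1:]))"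

lemma shift_Fract:
  assumes "q \<noteq> 0"
  shows "shift (Fract p q) = Fract (pcompose p [:1, 1:]) (pcompose q [:1, 1:])"
  unfolding shift_def
proof (rule the_equality)
  show "\<exists>r s. s \<noteq> 0 \<and> Fract p q = Fract r s \<and>
      Fract (pcompose p [:1, 1:]) (pcompose q [:1, 1:])
      = Fract (pcompose r [:1, 1:]) (pcompose s [:1, 1:])"
    using assms by blast
next
  fix g :: ratfun
  assume "\<exists>r s. s \<noteq> 0 \<and> Fract p q = Fract r s \<and>
      g = Fract (pcompose r [:1, 1:]) (pcompose s [:1, 1:])"
  then obtain r s where "s \<noteq> 0" and rs: "Fract p q = Fract r s"
    and g: "g = Fract (pcompose r [:1, 1:]) (pcompose s [:1, 1:])"
    by blast
  have "r * q = p * s"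
    using assms \<open>s \<noteq> 0\<close> rs by (simp add: eq_fract)
  then have "pcompose r [:1, 1:] * pcompose q [:1, 1:]
      = pcompose p [:1, 1:] * pcompose s [:1, 1:]"
    by (simp flip: pcompose_mult)
  moreover have "pcompose q [:1, 1:] \<noteq> 0" "pcompose s [:1, 1:] \<noteq> 0"
    using assms \<open>s \<noteq> 0\<close> by (auto dest: pcompose_eq_0)
  ultimately show "g = Fract (pcompose p [:1, 1:]) (pcompose q [:1, 1:])"
    by (simp add: g eq_fract)
qed

definition ell :: "nat \<Rightarrow> ratfun" where
  "ell r = (\<Prod>j = 1..(r - 1) div 2. X + of_nat j)"

text \<open>The value at index \<open>0\<close> is a dummy; the sequence starts at index \<open>1\<close>. The defining
  recurrences, cleared of denominators, are the lemmas \<open>P_odd_rec\<close> and \<open>P_even_rec\<close> below.\<close>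

fun P :: "nat \<Rightarrow> ratfun" where
  "P 0 = 0"
| "P (Suc 0) = 1"
| "P (Suc (Suc 0)) = 1"
| "P (Suc (Suc (Suc k))) =
    (let n = Suc (Suc k) in
      if odd n
      then (2 * (X + of_nat n) * P n + (2 * X + of_nat n) * shift (P n)
              + (4 * X + of_nat n) * ell n) / (4 * (2 * X + of_nat n))
      else (4 * (X + of_nat n) * P n + 2 * (2 * X + of_nat n + 1) * shift (P n)
              + (4 * X + of_nat n) * ell (n - 1)) / 4)"

lemma two_X_plus_nonzero: "2 * X + of_nat n \<noteq> 0"
proof -
  have two: "(2 :: ratfun) = Fract [:2:] 1"
    using of_nat_fract[of 2, where ?'a = "rat poly"] by (simp add: numeral_poly)
  have "(of_nat n :: ratfun) = Fract [:of_nat n:] 1"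
    by (simp add: of_nat_fract of_nat_poly)
  then have "2 * X + of_nat n = Fract [:of_nat n, 2:] 1"
    unfolding two X_def by simp
  then show ?thesis
    by (simp add: Zero_fract_def eq_fract)
qed

lemma P_one: "P 1 = 1" and P_two: "P 2 = 1"
  by (simp_all add: numeral_2_eq_2)

lemma P_odd_rec:
  assumes "n \<ge> 2" "odd n"
  shows "4 * (2 * X + of_nat n) * P (n + 1) =
    2 * (X + of_nat n) * P n + (2 * X + of_nat n) * shift (P n) + (4 * X + of_nat n) * ell n"
proof -
  obtain k where n: "n = Suc (Suc k)"
    using \<open>n \<ge> 2\<close> by (metis add_2_eq_Suc le_Suc_ex)
  have "P (n + 1) = (2 * (X + of_nat n) * P n + (2 * X + of_nat n) * shift (P n)
      + (4 * X + of_nat n) * ell n) / (4 * (2 * X + of_nat n))"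
    using \<open>odd n\<close> unfolding n Suc_eq_plus1[symmetric] P.simps(4) Let_def by (simp only: not_False_eq_True if_True)
  then show ?thesis
    using two_X_plus_nonzero[of n] by simp
qed

lemma P_even_rec:
  assumes "n \<ge> 2" "even n"
  shows "4 * P (n + 1) =
    4 * (X + of_nat n) * P n + 2 * (2 * X + of_nat n + 1) * shift (P n)
      + (4 * X + of_nat n) * ell (n - 1)"
proof -
  obtain k where n: "n = Suc (Suc k)"
    using \<open>n \<ge> 2\<close> by (metis add_2_eq_Suc le_Suc_ex)
  have "P (n + 1) = (4 * (X + of_nat n) * P n + 2 * (2 * X + of_nat n + 1) * shift (P n)
      + (4 * X + of_nat n) * ell (n - 1)) / 4"
    using \<open>even n\<close> unfolding n Suc_eq_plus1[symmetric] P.simps(4) Let_def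
    by (simp only: not_True_eq_False if_False)
  then show ?thesis
    by simp
qed

definition m :: "nat \<Rightarrow> nat" where
  "m n = (n - 1) div 2"

text \<open>\<open>b i n\<close> is the coefficient of \<open>binom(x, m n - i)\<close> in the expansion of \<open>P n\<close> in the
  binomial basis. The coefficient family is singled out by the expansion itself; the
  condition on indices above \<open>m n\<close> only makes it unique as a function on all of
  \<^typ>\<open>nat\<close>.\<close>

definition b :: "nat \<Rightarrow> nat \<Rightarrow> rat" where
  "b i n = (THE c :: nat \<Rightarrow> rat.
     P n = (\<Sum>j\<le>m n. of_rat (c j) * (X gchoose (m n - j))) \<and> (\<forall>j>m n. c j = 0)) i"

end

theory Submission
  imports Defs
begin

text \<open>With \<open>n = 2 h + 1\<close>, \<open>P\<^sub>n\<close> and \<open>P\<^sub>n\<^sub>+\<^sub>1\<close> are polynomials of degree at most \<open>h\<close>. The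
  only obstruction is the division by \<open>2 x + n\<close>, which requires
  \<open>P\<^sub>n(-n/2) = \<ell>\<^sub>n(-n/2)\<close>. The recurrences restricted to the points \<open>x = -(k + 1/2)\<close> form a
  closed system, whose solution is, up to elementary factors, the \<open>(n-1)\<close>-st Taylor coefficient at
  \<open>z = 1\<close> of the polynomial obtained by truncating the binomial series of
  \<open>(1 - 2 z) powr (k - 1/2) / ((-1/2) gchoose k)\<close> after the power \<open>2 k\<close>. This polynomial has
  leading coefficient and value at \<open>z = 1\<close> equal to \<open>1\<close>.

  In the basis of falling factorials, multiplication by \<open>x\<close> and the shift act on two neighbouring
  coefficients. Comparing coefficients, for odd \<open>n\<close> the first difference of \<open>b i n / (m - i)!\<close> in \<open>h\<close> is a
  combination, with coefficients polynomial in \<open>h\<close>, of the sequences for \<open>i - 1\<close> and \<open>i - 2\<close> and of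
  the coefficients of \<open>\<ell>\<close>, so this quotient is a polynomial in \<open>h\<close>; even \<open>n\<close> reduce to odd ones. The leading coefficients obey a recurrence
  with positive terms only, which gives the exact degree.\<close>

subsection \<open>Truncated binomial series with half-integral exponent\<close>

text \<open>The coefficient of z^i in (1 - 2 z)^(k - 1/2), scaled so that the last retained
  coefficient, at z^(2 k), becomes 1.\<close>

definition hcoeff :: "nat \<Rightarrow> nat \<Rightarrow> rat" where
  "hcoeff k i = ((of_nat k - 1/2) gchoose i) * (-2) ^ i / ((-1/2) gchoose k)"

text \<open>Since \<open>i choose N\<close> is the Taylor coefficient of order \<open>N\<close> of
  z^i at z = 1, this is the one of the truncated series.\<close>

definition hsum :: "nat \<Rightarrow> nat \<Rightarrow> rat" where
  "hsum N k = (\<Sum>i\<le>2 * k. hcoeff k i * of_nat (i choose N))"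

lemma gbinomial_minus_half_Suc:
  "of_nat (Suc k) * ((-1/2 :: rat) gchoose Suc k) = - (of_nat k + 1/2) * ((-1/2) gchoose k)"
  using gbinomial_mult_1[of "-1/2 :: rat" k] by (simp add: algebra_simps)

lemma gbinomial_minus_half_nonzero: "((-1/2 :: rat) gchoose k) \<noteq> 0"
proof (induction k)
  case (Suc k)
  have "(of_nat k + 1/2 :: rat) \<noteq> 0"
    by (smt (verit) of_nat_0_le_iff zero_less_divide_1_iff zero_less_numeral add_nonneg_pos less_irrefl)
  then have "- (of_nat k + 1/2) * ((-1/2 :: rat) gchoose k) \<noteq> 0"
    using Suc by simp
  then show ?case
    unfolding gbinomial_minus_half_Suc[symmetric] by (metis mult_zero_right)
qed simp

lemma hcoeff_mult:
  "hcoeff k i * ((-1/2) gchoose k) = ((of_nat k - 1/2) gchoose i) * (-2) ^ i"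
  using gbinomial_minus_half_nonzero[of k] by (simp add: hcoeff_def)

text \<open>With g = (1 - 2 z)^(k + 1/2), this is (k + 1/2) g - z g' = (k + 1/2) (1 - 2 z)^(k - 1/2)
  read off at z^i. The scaling turns the factor k + 1/2 on the right into -(k + 1).\<close>

lemma hcoeff_Suc_left:
  "(of_nat k + 1/2 - of_nat i) * hcoeff (Suc k) i = - of_nat (Suc k) * hcoeff k i"
proof -
  let ?w = "\<lambda>k. (-1/2 :: rat) gchoose k"
  let ?g = "(of_nat k + 1/2 :: rat) gchoose i"
  let ?h = "(of_nat k - 1/2 :: rat) gchoose i"
  have g: "(of_nat k + 1/2 - of_nat i) * ?g = (of_nat k + 1/2) * ?h"
    using gbinomial_absorb_comp[of "of_nat k + 1/2 :: rat" i] by (simp add: algebra_simps)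
  have c: "hcoeff (Suc k) i * ?w (Suc k) = ?g * (-2) ^ i" "hcoeff k i * ?w k = ?h * (-2) ^ i"
    using hcoeff_mult[of "Suc k" i] hcoeff_mult[of k i] by (simp_all add: algebra_simps)
  have "(of_nat k + 1/2 - of_nat i) * hcoeff (Suc k) i * ?w (Suc k)
      = (of_nat k + 1/2) * (hcoeff k i * ?w k)"
    unfolding mult.assoc c using g by (metis (no_types) mult.assoc)
  also have "\<dots> = - of_nat (Suc k) * hcoeff k i * ?w (Suc k)"
    using gbinomial_minus_half_Suc[of k] by algebra
  finally show ?thesis
    by (metis gbinomial_minus_half_nonzero mult_right_cancel)
qed

lemma hcoeff_Suc_right:
  "of_nat (Suc i) * hcoeff k (Suc i) = (of_nat (2 * i + 1) - 2 * of_nat k) * hcoeff k i"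
proof -
  let ?g = "\<lambda>i. (of_nat k - 1/2 :: rat) gchoose i"
  have g: "of_nat (Suc i) * ?g (Suc i) = (of_nat k - 1/2 - of_nat i) * ?g i"
    using gbinomial_mult_1[of "of_nat k - 1/2 :: rat" i] by (simp add: algebra_simps)
  have "of_nat (Suc i) * hcoeff k (Suc i) * ((-1/2) gchoose k)
      = (of_nat (Suc i) * ?g (Suc i)) * (-2 * (-2) ^ i)"
    by (simp only: mult.assoc hcoeff_mult power_Suc)
  also have "\<dots> = (of_nat (2 * i + 1) - 2 * of_nat k) * (?g i * (-2) ^ i)"
    unfolding g by (simp add: field_simps)
  also have "\<dots> = (of_nat (2 * i + 1) - 2 * of_nat k) * hcoeff k i * ((-1/2) gchoose k)"
    by (simp only: mult.assoc hcoeff_mult)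
  finally show ?thesis
    by (metis gbinomial_minus_half_nonzero mult_right_cancel)
qed

text \<open>By \<open>hcoeff_Suc_right\<close>, the successive ratios from index 2 k on are 1 and (k
  + 3/2) / (k + 1). The first claim passes from k to k + 1 by \<open>hcoeff_Suc_left\<close> at i =
  2 k + 2, where the left factor is -(k + 3/2).\<close>

lemma hcoeff_diag: "hcoeff k (2 * k) = 1"
  and hcoeff_diag1: "hcoeff k (Suc (2 * k)) = 1"
  and hcoeff_diag2: "of_nat (Suc k) * hcoeff k (Suc (Suc (2 * k))) = of_nat k + 3/2"
proof -
  have d1: "hcoeff k (Suc (2 * k)) = hcoeff k (2 * k)" for k
  proof -
    have "of_nat (Suc (2 * k)) * hcoeff k (Suc (2 * k)) = of_nat (Suc (2 * k)) * hcoeff k (2 * k)"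
      using hcoeff_Suc_right[of "2 * k" k] by (simp add: algebra_simps)
    then show ?thesis
      by (metis mult_left_cancel of_nat_neq_0)
  qed
  have d2: "of_nat (Suc k) * hcoeff k (Suc (Suc (2 * k))) = (of_nat k + 3/2) * hcoeff k (2 * k)" for k
    using hcoeff_Suc_right[of "Suc (2 * k)" k] d1[of k] by (simp add: algebra_simps)
  show d: "hcoeff k (2 * k) = 1"
  proof (induction k)
    case 0
    show ?case by (simp add: hcoeff_def)
  next
    case (Suc k)
    have "- (of_nat k + 3/2) * hcoeff (Suc k) (2 * Suc k) = - (of_nat k + 3/2)"
      using hcoeff_Suc_left[of k "2 * Suc k"] d2[of k] Suc by (simp add: algebra_simps)
    moreover have "(of_nat k + 3/2 :: rat) > 0"
      by (intro add_nonneg_pos) auto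
    ultimately show ?case by (metis less_irrefl mult_cancel_left1 mult.right_neutral mult_left_cancel neg_0_equal_iff_equal)
  qed
  show "hcoeff k (Suc (2 * k)) = 1"
    using d d1 by simp
  show "of_nat (Suc k) * hcoeff k (Suc (Suc (2 * k))) = of_nat k + 3/2"
    using d d2 by simp
qed

text \<open>The partial sums are computed by Pascal's rule for the upper index \<open>k + 1/2\<close>.\<close>

lemma hsum_0: "hsum 0 k = 1"
proof -
  let ?w = "\<lambda>k. (-1/2 :: rat) gchoose k"
  define a where "a k i = ((of_nat k - 1/2 :: rat) gchoose i) * (-2) ^ i" for k i :: nat
  have a: "a k i = hcoeff k i * ?w k" for k i
    using gbinomial_minus_half_nonzero[of k] by (simp add: a_def hcoeff_def)
  have pascal: "a (Suc k) (Suc i) = a k (Suc i) - 2 * a k i" for k i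
    using gbinomial_Suc_Suc[of "of_nat k - 1/2 :: rat" i] by (simp add: a_def algebra_simps)
  \<comment> \<open>If S(n) denotes the partial sums of \<open>a k\<close>, Pascal's rule gives S(n)
    - 2 S(n - 1), which is \<open>2 * a k n\<close> minus S(n).\<close>
  have ps: "(\<Sum>i\<le>n. a (Suc k) i) = 2 * a k n - (\<Sum>i\<le>n. a k i)" for k n
    by (induction n) (simp_all add: pascal, simp add: a_def)
  have "(\<Sum>i\<le>2 * k. a k i) = ?w k"
  proof (induction k)
    case (Suc k)
    \<comment> \<open>The sum up to 2 k cancels against the term at 2 k + 1, so only the top term
      remains.\<close>
    have "(\<Sum>i\<le>2 * Suc k. a (Suc k) i)
        = (\<Sum>i\<le>2 * k. a (Suc k) i) + a (Suc k) (Suc (2 * k)) + a (Suc k) (2 * Suc k)"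
      by simp
    also have "(\<Sum>i\<le>2 * k. a (Suc k) i) = ?w k"
      unfolding ps Suc by (simp add: a hcoeff_diag)
    also have "a (Suc k) (Suc (2 * k)) = - ?w k"
      by (simp add: pascal a[of k] hcoeff_diag hcoeff_diag1)
    also have "a (Suc k) (2 * Suc k) = ?w (Suc k)"
      by (simp only: a hcoeff_diag)
    finally show ?case by simp
  qed (simp add: a_def)
  then show ?thesis
    using gbinomial_minus_half_nonzero[of k]
    by (simp add: hsum_def a flip: sum_distrib_right)
qed

text \<open>Write (N + 1) (i choose N + 1) as (i - N) (i choose N) and split i - N into (k + 1/2 -
  N) - (k + 1/2 - i); \<open>hcoeff_Suc_left\<close> lowers k in the second part.\<close>

lemma hsum_Suc:
  "of_nat (Suc N) * hsum (Suc N) (Suc k) =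
     (of_nat k + 1/2 - of_nat N) * hsum N (Suc k) + of_nat (Suc k) * hsum N k
       + (4 * of_nat k + 5 - of_nat N) / 2 * of_nat ((2 * k + 2) choose N)"
proof -
  let ?c = "\<lambda>i. of_nat (i choose N) :: rat"
  have cS: "of_nat (Suc N) * (of_nat (i choose Suc N) :: rat) = (of_nat i - of_nat N) * ?c i" for i
    using gbinomial_mult_1[of "of_nat i :: rat" N]
    by (simp add: algebra_simps binomial_gbinomial)
  have "of_nat (Suc N) * hsum (Suc N) (Suc k)
      = (\<Sum>i\<le>2 * Suc k. hcoeff (Suc k) i * (of_nat (Suc N) * of_nat (i choose Suc N)))"
    unfolding hsum_def sum_distrib_left by (rule sum.cong) simp_all
  also have "\<dots> = (\<Sum>i\<le>2 * Suc k. (of_nat k + 1/2 - of_nat N) * (hcoeff (Suc k) i * ?c i)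
       - ((of_nat k + 1/2 - of_nat i) * hcoeff (Suc k) i) * ?c i)"
    unfolding cS by (rule sum.cong) (simp_all add: algebra_simps)
  also have "\<dots> = (of_nat k + 1/2 - of_nat N) * hsum N (Suc k)
       + of_nat (Suc k) * (\<Sum>i\<le>2 * Suc k. hcoeff k i * ?c i)"
    unfolding hcoeff_Suc_left hsum_def sum_subtractf mult.assoc sum_distrib_left
    by (simp del: sum.atMost_Suc of_nat_Suc add: sum_negf)
  \<comment> \<open>The range exceeds the truncation for k by two indices; these two terms form the
    inhomogeneous part.\<close>
  also have "(\<Sum>i\<le>2 * Suc k. hcoeff k i * ?c i)
      = hsum N k + ?c (2 * k + 1) + hcoeff k (Suc (Suc (2 * k))) * ?c (2 * k + 2)"
    by (simp add: hsum_def hcoeff_diag1)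
  also have "of_nat (Suc k) * \<dots> = of_nat (Suc k) * hsum N k + of_nat (Suc k) * ?c (2 * k + 1)
      + (of_nat k + 3/2) * ?c (2 * k + 2)"
    unfolding distrib_left mult.assoc[symmetric] hcoeff_diag2 ..
  also have "of_nat (Suc k) * ?c (2 * k + 1) = (2 * of_nat k + 2 - of_nat N) / 2 * ?c (2 * k + 2)"
  proof -
    have "(of_nat (Suc (Suc (2 * k))) - of_nat N) * ((of_nat (Suc (Suc (2 * k))) :: rat) gchoose N)
        = of_nat (Suc (Suc (2 * k))) * ((of_nat (Suc (2 * k))) gchoose N)"
      using gbinomial_absorb_comp[of "of_nat (Suc (Suc (2 * k))) :: rat" N] by simp
    then show ?thesis
      by (simp add: binomial_gbinomial algebra_simps)
  qed
  finally show ?thesis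
    by (simp add: field_simps)
qed

text \<open>The leading coefficient of the truncated series. This value makes the division in
  \<open>P_even\<close> exact.\<close>

lemma hsum_diag: "hsum (2 * k) k = 1"
proof -
  have "hsum (2 * k) k = (\<Sum>i\<le>2 * k. if i = 2 * k then 1 else 0)"
    unfolding hsum_def by (rule sum.cong) (auto simp: hcoeff_diag binomial_eq_0)
  then show ?thesis by simp
qed

lemma hsum_eq_0: "2 * k < N \<Longrightarrow> hsum N k = 0"
  unfolding hsum_def by (rule sum.neutral) (auto simp: binomial_eq_0)

subsection \<open>Polynomiality and values at half-integers\<close>

abbreviation shift_poly :: "rat poly \<Rightarrow> rat poly" where
  "shift_poly p \<equiv> pcompose p [:1, 1:]"

definition ell_poly :: "nat \<Rightarrow> rat poly" where
  "ell_poly h = (\<Prod>j = 1..h. [:of_nat j, 1:])"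

text \<open>These are to be P(2 h + 1) and P(2 h + 2). Here \<open>div\<close> is division with
  remainder; its exactness is proved in \<open>P_even_mult\<close>.\<close>

fun P_odd P_even :: "nat \<Rightarrow> rat poly" where
  "P_odd 0 = 1"
| "P_odd (Suc h) = smult (1/4) ([:8 * of_nat h + 8, 4:] * P_even h
     + [:4 * of_nat h + 6, 4:] * shift_poly (P_even h) + [:2 * of_nat h + 2, 4:] * ell_poly h)"
| "P_even h = ([:4 * of_nat h + 2, 2:] * P_odd h + [:2 * of_nat h + 1, 2:] * shift_poly (P_odd h)
     + [:2 * of_nat h + 1, 4:] * ell_poly h) div [:8 * of_nat h + 4, 8:]"

declare P_even.simps [simp del]

text \<open>The root of 2 x + 2 k + 1. The shift maps the value at node k + 1 to the value at node
  k, so the recurrences close up on these points.\<close>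

abbreviation half_node :: "nat \<Rightarrow> rat" where
  "half_node k \<equiv> - (of_nat k + 1/2)"

lemma ell_poly_0 [simp]: "ell_poly 0 = 1"
  and ell_poly_Suc: "ell_poly (Suc h) = [:of_nat h + 1, 1:] * ell_poly h"
  by (simp_all add: ell_poly_def algebra_simps)

lemma poly_shift_half_node: "poly (shift_poly p) (half_node (Suc k)) = poly p (half_node k)"
  by (simp add: poly_pcompose algebra_simps)

text \<open>Moving the node by one shifts the factors of the product, so the two values differ only
  in one end factor each.\<close>

lemma ell_poly_half_node_Suc:
  "(2 * of_nat k + 1) * poly (ell_poly h) (half_node k)
     = (2 * of_nat k + 1 - 2 * of_nat h) * poly (ell_poly h) (half_node (Suc k))"
proof (induction h)
  case (Suc h)
  have "(2 * of_nat k + 1) * poly (ell_poly (Suc h)) (half_node k)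
      = (of_nat h + 1/2 - of_nat k) * ((2 * of_nat k + 1) * poly (ell_poly h) (half_node k))"
    by (simp add: ell_poly_Suc algebra_simps)
  also have "\<dots> = (2 * of_nat k + 1 - 2 * of_nat (Suc h)) * poly (ell_poly (Suc h)) (half_node (Suc k))"
    unfolding Suc by (simp add: ell_poly_Suc field_simps)
  finally show ?case .
qed simp

lemma choose_Suc_right:
  "of_nat (Suc i) * (of_nat (n choose Suc i) :: rat) = (of_nat n - of_nat i) * of_nat (n choose i)"
  using gbinomial_mult_1[of "of_nat n :: rat" i] by (simp add: algebra_simps binomial_gbinomial)

lemma choose_Suc_Suc_left:
  "(of_nat n + 2 - of_nat i) * (of_nat n + 1 - of_nat i) * (of_nat (Suc (Suc n) choose i) :: rat)
    = (of_nat n + 2) * (of_nat n + 1) * of_nat (n choose i)"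
proof -
  have 1: "(of_nat n + 1 - of_nat i) * (of_nat (Suc n choose i) :: rat) = (of_nat n + 1) * of_nat (n choose i)" for n
    using gbinomial_absorb_comp[of "of_nat n + 1 :: rat" i] by (simp add: binomial_gbinomial algebra_simps)
  have 2: "(of_nat n + 2 - of_nat i) * (of_nat (Suc (Suc n) choose i) :: rat) = (of_nat n + 2) * of_nat (Suc n choose i)"
    using 1[of "Suc n"] by (simp add: algebra_simps)
  show ?thesis using 1[of n] 2 by algebra
qed

text \<open>The values at half-integers are \<open>\<ell>\<close> times a ratio of \<open>hsum\<close> and a binomial coefficient;
  both sides are multiplied by the latter, which vanishes for small \<open>k\<close>.\<close>

definition odd_values :: "nat \<Rightarrow> bool" where
  "odd_values h \<longleftrightarrow> (\<forall>k. of_nat (2 * k choose (2 * h)) * poly (P_odd h) (half_node k)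
     = poly (ell_poly h) (half_node k) * hsum (2 * h) k)"

definition even_values :: "nat \<Rightarrow> bool" where
  "even_values h \<longleftrightarrow> (\<forall>k. 2 * of_nat (2 * k choose (2 * h + 1)) * poly (P_even h) (half_node k)
     = poly (ell_poly h) (half_node k) * hsum (2 * h + 1) k)"

text \<open>At node h the binomial coefficient and \<open>hsum\<close> are both 1, so
  \<open>P_odd\<close> and \<open>ell_poly\<close> agree there. Their factors are 2 h + 1 and -(2 h
  + 1), and the factor of the shifted term is zero; hence the root of the divisor is a root of the
  numerator.\<close>

lemma P_even_mult:
  assumes "odd_values h"
  shows "[:8 * of_nat h + 4, 8:] * P_even h = [:4 * of_nat h + 2, 2:] * P_odd h
     + [:2 * of_nat h + 1, 2:] * shift_poly (P_odd h) + [:2 * of_nat h + 1, 4:] * ell_poly h"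
    (is "_ = ?N")
proof -
  have "poly (P_odd h) (half_node h) = poly (ell_poly h) (half_node h)"
    using assms[unfolded odd_values_def, rule_format, of h] by (simp add: hsum_diag)
  then have "poly ?N (half_node h) = 0"
    by (simp add: field_simps)
  then have "[:- half_node h, 1:] dvd ?N"
    by (simp only: poly_eq_0_iff_dvd)
  moreover have "[:8 * of_nat h + 4, 8:] = smult 8 [:- half_node h, 1:]"
    by simp
  ultimately have "[:8 * of_nat h + 4, 8:] dvd ?N"
    by (metis smult_dvd zero_neq_numeral)
  then show ?thesis
    unfolding P_even.simps[of h] by (rule dvd_mult_div_cancel)
qed

text \<open>At node k = j + 1 the recurrence involves nodes k and j only. After multiplication by
  the binomial coefficient it becomes \<open>hsum_Suc\<close> with N = 2 h, times the value of
  \<open>ell_poly\<close>.\<close>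

lemma even_valuesI:
  assumes "odd_values h"
  shows "even_values h"
  unfolding even_values_def
proof
  fix k
  show "2 * of_nat (2 * k choose (2 * h + 1)) * poly (P_even h) (half_node k)
     = poly (ell_poly h) (half_node k) * hsum (2 * h + 1) k" (is ?thesis)
  proof (cases "k \<le> h")
    case True
    then show ?thesis by (simp add: hsum_eq_0 binomial_eq_0)
  next
    case False
    then obtain j where k: "k = Suc j" and "h \<le> j"
      by (metis Suc_le_D not_less_eq_eq)
    let ?c = "of_nat (2 * k choose (2 * h)) :: rat"
    let ?d = "of_nat (2 * k choose (2 * h + 1)) :: rat"
    let ?e = "of_nat (2 * j choose (2 * h)) :: rat"
    define l l' f f' g where "l = poly (ell_poly h) (half_node k)"
      and "l' = poly (ell_poly h) (half_node j)"
      and "f = poly (P_odd h) (half_node k)" and "f' = poly (P_odd h) (half_node j)"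
      and "g = poly (P_even h) (half_node k)"
    have r: "8 * (of_nat h - of_nat j - 1) * g = (4 * of_nat h - 2 * of_nat j - 1) * f
        + 2 * (of_nat h - of_nat j - 1) * f' + (2 * of_nat h - 5 - 4 * of_nat j) * l"
      using arg_cong[OF P_even_mult[OF assms], of "\<lambda>p. poly p (half_node k)"]
      unfolding k poly_add poly_mult poly_shift_half_node g_def f_def f'_def l_def
      by (simp add: algebra_simps)
    have f: "?c * f = l * hsum (2 * h) k" and f': "?e * f' = l' * hsum (2 * h) j"
      using assms unfolding odd_values_def f_def f'_def l_def l'_def by blast+
    have l: "(2 * of_nat j + 1) * l' = (2 * of_nat j + 1 - 2 * of_nat h) * l"
      unfolding l_def l'_def k by (rule ell_poly_half_node_Suc)
    \<comment> \<open>Up to sign and a constant, the factor on the right is the value of the divisor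
      at the node, so the division is absorbed into the change of binomial coefficient.\<close>
    have cd: "(2 * of_nat h + 1) * ?d = 2 * (of_nat j + 1 - of_nat h) * ?c"
      using choose_Suc_right[of "2 * h" "2 * k"] by (simp add: k algebra_simps)
    have ce: "2 * (of_nat j + 1 - of_nat h) * (2 * of_nat j + 1 - 2 * of_nat h) * ?c
        = 2 * (of_nat j + 1) * (2 * of_nat j + 1) * ?e"
      using choose_Suc_Suc_left[of "2 * j" "2 * h"] by (simp add: k algebra_simps)
    have nz: "(2 * of_nat j + 1 - 2 * of_nat h :: rat) \<noteq> 0" "(2 * of_nat h + 1 :: rat) \<noteq> 0"
      using \<open>h \<le> j\<close> by (simp_all add: algebra_simps of_nat_le_iff[symmetric, where ?'a=rat] del: of_nat_le_iff)
    \<comment> \<open>The data at node j are rewritten with the binomial coefficient and the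
      \<open>ell_poly\<close> value of node k; the common factor is positive since h <= j.\<close>
    have "(2 * of_nat j + 1 - 2 * of_nat h) * (2 * (of_nat j + 1 - of_nat h) * ?c * f')
        = (2 * of_nat j + 1 - 2 * of_nat h) * (2 * (of_nat j + 1) * l * hsum (2 * h) j)"
      using ce f' l by algebra
    then have cf': "2 * (of_nat j + 1 - of_nat h) * ?c * f' = 2 * (of_nat j + 1) * l * hsum (2 * h) j"
      using nz(1) by (metis mult_left_cancel)
    have H: "(2 * of_nat h + 1) * hsum (2 * h + 1) k = (of_nat j + 1/2 - 2 * of_nat h) * hsum (2 * h) k
        + (of_nat j + 1) * hsum (2 * h) j + (4 * of_nat j + 5 - 2 * of_nat h) / 2 * ?c"
      using hsum_Suc[of "2 * h" j] by (simp add: k algebra_simps)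
    have "4 * (2 * of_nat h + 1) * (2 * ?d * g) = 4 * (2 * of_nat h + 1) * (l * hsum (2 * h + 1) k)"
    proof -
      have "4 * (2 * of_nat h + 1) * (2 * ?d * g) = - 2 * (?c * (8 * (of_nat h - of_nat j - 1) * g))"
        using cd by algebra
      also have "\<dots> = 4 * (l * ((2 * of_nat h + 1) * hsum (2 * h + 1) k))"
        unfolding r H using f cf' by algebra
      finally show ?thesis by (simp only: mult_ac)
    qed
    then have "2 * ?d * g = l * hsum (2 * h + 1) k"
      using nz(2) by (metis mult_left_cancel mult_eq_0_iff zero_neq_numeral)
    then show ?thesis
      by (simp only: g_def l_def)
  qed
qed

text \<open>The same comparison with \<open>hsum_Suc\<close> at N = 2 h + 1. The change of binomial
  coefficient now supplies the new factor of \<open>ell_poly (Suc h)\<close>.\<close>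

lemma odd_values_Suc:
  assumes "even_values h"
  shows "odd_values (Suc h)"
  unfolding odd_values_def
proof
  fix k
  show "of_nat (2 * k choose (2 * Suc h)) * poly (P_odd (Suc h)) (half_node k)
     = poly (ell_poly (Suc h)) (half_node k) * hsum (2 * Suc h) k" (is ?thesis)
  proof (cases "k \<le> h")
    case True
    then show ?thesis by (simp add: hsum_eq_0 binomial_eq_0)
  next
    case False
    then obtain j where k: "k = Suc j" and "h \<le> j"
      by (metis Suc_le_D not_less_eq_eq)
    let ?c = "of_nat (2 * k choose (2 * h + 1)) :: rat"
    let ?d = "of_nat (2 * k choose (2 * Suc h)) :: rat"
    let ?e = "of_nat (2 * j choose (2 * h + 1)) :: rat"
    define l l' g g' f where "l = poly (ell_poly h) (half_node k)"
      and "l' = poly (ell_poly h) (half_node j)"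
      and "g = poly (P_even h) (half_node k)" and "g' = poly (P_even h) (half_node j)"
      and "f = poly (P_odd (Suc h)) (half_node k)"
    have r: "4 * f = (8 * of_nat h + 2 - 4 * of_nat j) * g
        + 4 * (of_nat h - of_nat j) * g' + (2 * of_nat h - 4 - 4 * of_nat j) * l"
      unfolding f_def P_odd.simps poly_smult k poly_add poly_mult poly_shift_half_node g_def g'_def l_def
      by (simp add: field_simps)
    have g: "2 * ?c * g = l * hsum (2 * h + 1) k" and g': "2 * ?e * g' = l' * hsum (2 * h + 1) j"
      using assms unfolding even_values_def g_def g'_def l_def l'_def by blast+
    have l: "(2 * of_nat j + 1) * l' = (2 * of_nat j + 1 - 2 * of_nat h) * l"
      unfolding l_def l'_def k by (rule ell_poly_half_node_Suc)
    have lS: "poly (ell_poly (Suc h)) (half_node k) = (of_nat h - 1/2 - of_nat j) * l"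
      by (simp add: ell_poly_Suc l_def k algebra_simps)
    have cd: "(2 * of_nat h + 2) * ?d = (2 * of_nat j + 1 - 2 * of_nat h) * ?c"
      using choose_Suc_right[of "2 * h + 1" "2 * k"] by (simp add: k algebra_simps)
    have ce: "2 * (of_nat j - of_nat h) * (2 * of_nat j + 1 - 2 * of_nat h) * ?c
        = 2 * (of_nat j + 1) * (2 * of_nat j + 1) * ?e"
      using choose_Suc_Suc_left[of "2 * j" "2 * h + 1"] by (simp add: k algebra_simps)
    have nz: "(2 * of_nat j + 1 - 2 * of_nat h :: rat) \<noteq> 0" "(2 * of_nat h + 2 :: rat) \<noteq> 0"
      using \<open>h \<le> j\<close> by (simp_all add: algebra_simps of_nat_le_iff[symmetric, where ?'a=rat] del: of_nat_le_iff)
    have "(2 * of_nat j + 1 - 2 * of_nat h) * (2 * (of_nat j - of_nat h) * (2 * ?c * g'))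
        = (2 * of_nat j + 1 - 2 * of_nat h) * (2 * (of_nat j + 1) * l * hsum (2 * h + 1) j)"
      using ce g' l by algebra
    then have cg': "2 * (of_nat j - of_nat h) * (2 * ?c * g') = 2 * (of_nat j + 1) * l * hsum (2 * h + 1) j"
      using nz(1) by (metis mult_left_cancel)
    have H: "(2 * of_nat h + 2) * hsum (2 * Suc h) k = (of_nat j - 1/2 - 2 * of_nat h) * hsum (2 * h + 1) k
        + (of_nat j + 1) * hsum (2 * h + 1) j + (4 * of_nat j + 4 - 2 * of_nat h) / 2 * ?c"
      using hsum_Suc[of "2 * h + 1" j] by (simp add: k algebra_simps)
    have "4 * (2 * of_nat h + 2) * (?d * f)
        = 4 * (2 * of_nat h + 2) * ((of_nat h - 1/2 - of_nat j) * l * hsum (2 * Suc h) k)"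
    proof -
      have "4 * (2 * of_nat h + 2) * (?d * f) = (2 * of_nat j + 1 - 2 * of_nat h) * ?c * (4 * f)"
        using cd by algebra
      also have "\<dots> = 4 * ((of_nat h - 1/2 - of_nat j) * l * ((2 * of_nat h + 2) * hsum (2 * Suc h) k))"
        unfolding r H using g cg' by algebra
      finally show ?thesis by (simp only: mult_ac)
    qed
    then have "?d * f = (of_nat h - 1/2 - of_nat j) * l * hsum (2 * Suc h) k"
      using nz(2) by (metis mult_left_cancel mult_eq_0_iff zero_neq_numeral)
    then show ?thesis
      by (simp only: f_def lS)
  qed
qed

lemma odd_values: "odd_values h"
proof (induction h)
  case 0
  show ?case by (simp add: odd_values_def hsum_0)
qed (blast intro: even_valuesI odd_values_Suc)

lemmas P_even_rec_poly = P_even_mult[OF odd_values]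

section \<open>Degree bounds\<close>

lemma degree_ell_poly: "degree (ell_poly h) \<le> h"
proof (induction h)
  case (Suc h)
  then show ?case
    unfolding ell_poly_Suc by (intro order.trans[OF degree_mult_le]) simp
qed simp

lemma degree_linear_mult_le: "degree p \<le> n \<Longrightarrow> degree ([:c, d:] * p) \<le> Suc n" for p :: "rat poly"
  by (rule order.trans[OF degree_mult_le]) simp

lemma degree_shift_poly: "degree (shift_poly p) = degree p"
  by (simp add: degree_pcompose)

lemma degree_P_even_if:
  assumes "degree (P_odd h) \<le> h"
  shows "degree (P_even h) \<le> h"
proof (cases "P_even h = 0")
  case False
  then have "Suc (degree (P_even h)) = degree ([:8 * of_nat h + 4, 8:] * P_even h)"
    by (subst degree_mult_eq) auto
  also have "\<dots> \<le> Suc h"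
    unfolding P_even_rec_poly using assms
    by (intro degree_add_le degree_linear_mult_le) (simp_all add: degree_shift_poly degree_ell_poly)
  finally show ?thesis by simp
qed simp

lemma degree_P_odd: "degree (P_odd h) \<le> h"
proof (induction h)
  case (Suc h)
  have "degree ([:8 * of_nat h + 8, 4:] * P_even h + [:4 * of_nat h + 6, 4:] * shift_poly (P_even h)
      + [:2 * of_nat h + 2, 4:] * ell_poly h) \<le> Suc h"
    using degree_P_even_if[OF Suc]
    by (intro degree_add_le degree_linear_mult_le) (simp_all add: degree_shift_poly degree_ell_poly)
  then show ?case
    by (simp add: degree_smult_eq)
qed simp

lemmas degree_P_even = degree_P_even_if[OF degree_P_odd]

section \<open>Transfer from polynomials to rational functions\<close>

lemma of_nat_eq_to_fract: "(of_nat k :: ratfun) = to_fract (of_nat k)"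
  by (simp add: of_nat_fract to_fract_def)

lemma numeral_eq_to_fract: "(numeral k :: ratfun) = to_fract (numeral k)"
  using of_nat_eq_to_fract[of "numeral k"] by simp

lemma X_eq_to_fract: "X = to_fract [:0, 1:]"
  by (simp add: X_def to_fract_def)

lemma of_rat_eq_to_fract: "(of_rat c :: ratfun) = to_fract [:c:]"
proof (cases c)
  case (Fract u v)
  have of_int: "(of_int w :: ratfun) = to_fract [:of_int w:]" for w
    by (cases w rule: int_cases2) (simp_all add: of_nat_eq_to_fract of_nat_poly flip: to_fract_uminus)
  have "of_int v * (of_rat c :: ratfun) = of_int u"
    using Fract by (simp add: of_rat_rat)
  also have "of_int u = of_int v * to_fract [:c:]"
    unfolding of_int to_fract_mult[symmetric] to_fract_eq_iff using Fract by (simp add: Fract_of_int_quotient)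
  finally show ?thesis
    using Fract by simp
qed

lemma shift_poly_1: "shift_poly 1 = 1"
  by (simp add: one_pCons)

lemma shift_to_fract: "shift (to_fract p) = to_fract (shift_poly p)"
  by (simp add: to_fract_def shift_Fract shift_poly_1)

lemma ell_eq_to_fract: "ell (2 * h + 1) = to_fract (ell_poly h)"
proof -
  have "X + of_nat j = to_fract [:of_nat j, 1:]" for j
    by (simp add: X_eq_to_fract of_nat_eq_to_fract of_nat_poly flip: to_fract_add)
  moreover have "to_fract (\<Prod>j = 1..h. p j) = (\<Prod>j = 1..h. to_fract (p j))" for p :: "nat \<Rightarrow> rat poly"
    by (induction h) simp_all
  ultimately show ?thesis
    by (simp add: ell_def ell_poly_def)
qed

lemma to_fract_linear: "to_fract [:of_nat d, of_nat c:] = of_nat c * X + of_nat d"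
  by (simp add: X_eq_to_fract of_nat_eq_to_fract of_nat_poly flip: to_fract_add to_fract_mult)

lemma P_eq_to_fract:
  "P (2 * h + 1) = to_fract (P_odd h) \<and> P (2 * h + 2) = to_fract (P_even h)"
proof (induction h)
  case 0
  have "[:4, 8:] * P_even 0 = [:4, 8:] * 1"
    using P_even_rec_poly[of 0] by (simp add: shift_poly_1)
  then have "P_even 0 = 1"
    by (subst (asm) mult_left_cancel) simp_all
  then show ?case
    by (simp add: P_one P_two)
next
  case (Suc h)
  have lin: "to_fract [:8 * of_nat h + 8, 4:] = 4 * (X + of_nat (2 * h + 2))"
    "to_fract [:4 * of_nat h + 6, 4:] = 2 * (2 * X + of_nat (2 * h + 2) + 1)"
    "to_fract [:2 * of_nat h + 2, 4:] = 4 * X + of_nat (2 * h + 2)"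
    using to_fract_linear[of "8 * h + 8" 4] to_fract_linear[of "4 * h + 6" 4]
      to_fract_linear[of "2 * h + 2" 4]
    by (simp_all add: algebra_simps)
  have lin': "to_fract [:8 * of_nat (Suc h) + 4, 8:] = 4 * (2 * X + of_nat (2 * h + 3))"
    "to_fract [:4 * of_nat (Suc h) + 2, 2:] = 2 * (X + of_nat (2 * h + 3))"
    "to_fract [:2 * of_nat (Suc h) + 1, 2:] = 2 * X + of_nat (2 * h + 3)"
    "to_fract [:2 * of_nat (Suc h) + 1, 4:] = 4 * X + of_nat (2 * h + 3)"
    using to_fract_linear[of "8 * h + 12" 8] to_fract_linear[of "4 * h + 6" 2]
      to_fract_linear[of "2 * h + 3" 2] to_fract_linear[of "2 * h + 3" 4]
    by (simp_all add: algebra_simps)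
  have 4: "to_fract (smult (1/4) p) = to_fract p / 4" for p :: "rat poly"
  proof -
    have "to_fract p = 4 * to_fract (smult (1/4) p)"
      by (simp add: numeral_eq_to_fract numeral_poly flip: to_fract_mult)
    then show ?thesis by simp
  qed
  have idx: "2 * h + 2 + 1 = 2 * h + 3" "2 * h + 2 - 1 = 2 * h + 1" "2 * h + 3 + 1 = 2 * h + 4"
    "2 * h + 3 = 2 * Suc h + 1" "2 * h + 4 = 2 * Suc h + 2"
    by simp_all
  have "4 * P (2 * h + 3) = 4 * to_fract (P_odd (Suc h))"
    unfolding P_odd.simps 4 to_fract_add to_fract_mult lin
    using P_even_rec[of "2 * h + 2"]
    unfolding idx(1,2) conjunct2[OF Suc] ell_eq_to_fract shift_to_fract
    by (simp del: P.simps)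
  then have odd: "P (2 * h + 3) = to_fract (P_odd (Suc h))"
    by simp
  let ?d = "to_fract [:8 * of_nat (Suc h) + 4, 8:]"
  \<comment> \<open>Exactness of the division lets both sides be compared after multiplication by
    the nonzero divisor.\<close>
  have "?d * P (2 * h + 4) = ?d * to_fract (P_even (Suc h))"
    unfolding to_fract_mult[symmetric] P_even_rec_poly to_fract_add
    unfolding to_fract_mult lin'
    using P_odd_rec[of "2 * h + 3"] ell_eq_to_fract[of "Suc h"]
    unfolding idx(3) odd shift_to_fract idx(4)[symmetric]
    by (simp del: P.simps)
  then have "P (2 * h + 4) = to_fract (P_even (Suc h))"
    by simp
  with odd show ?case
    by (simp only: idx(4,5))
qed

subsection \<open>Newton expansion\<close>

text \<open>The k-th forward difference at 0 divided by k!, that is, the coefficient of the falling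
  factorial of degree k in Newton's formula.\<close>

primrec newton :: "nat \<Rightarrow> rat poly \<Rightarrow> rat" where
  "newton 0 p = poly p 0"
| "newton (Suc k) p = newton k (shift_poly p - p) / of_nat (Suc k)"

lemma newton_add: "newton k (p + q) = newton k p + newton k q"
  by (induction k arbitrary: p q) (simp_all add: pcompose_add add_diff_add add_divide_distrib)

lemma newton_smult: "newton k (smult c p) = c * newton k p"
  by (induction k arbitrary: p) (simp_all add: pcompose_smult flip: smult_diff_right)

lemma newton_sum: "newton k (\<Sum>i\<in>A. p i) = (\<Sum>i\<in>A. newton k (p i))"
proof -
  have "newton k 0 = 0" using newton_smult[of k 0 0] by simp
  then show ?thesis
    by (induction A rule: infinite_finite_induct) (simp_all add: newton_add)
qed

lemma newton_diff: "newton k (p - q) = newton k p - newton k q"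
  using newton_add[of k p "smult (-1) q"] newton_smult[of k "-1" q] by simp

lemma newton_shift_poly: "newton k (shift_poly p) = newton k p + of_nat (Suc k) * newton (Suc k) p"
  using newton_add[of k p "shift_poly p - p"] by simp

text \<open>Dual to x (x)_k = (x)_(k+1) + k (x)_k for falling factorials (x)_k. The induction uses
  the difference of a product with x: x times the difference of p, plus the shift of p.\<close>

lemma newton_pCons:
  "newton k (pCons 0 p) = of_nat k * newton k p + (if k = 0 then 0 else newton (k - 1) p)"
proof (induction k arbitrary: p)
  case (Suc k)
  have "shift_poly (pCons 0 p) - pCons 0 p = pCons 0 (shift_poly p - p) + shift_poly p"
    by (simp add: pcompose_pCons algebra_simps)
  then have "of_nat (Suc k) * newton (Suc k) (pCons 0 p)
      = newton k (pCons 0 (shift_poly p - p)) + newton k (shift_poly p)"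
    by (simp add: newton_add)
  also have "\<dots> = of_nat k * (of_nat (Suc k) * newton (Suc k) p)
      + (if k = 0 then 0 else of_nat k * newton k p) + newton k p + of_nat (Suc k) * newton (Suc k) p"
    unfolding Suc newton_shift_poly by (cases k) simp_all
  also have "\<dots> = of_nat (Suc k) * (of_nat (Suc k) * newton (Suc k) p + newton k p)"
    by (simp add: algebra_simps del: newton.simps)
  finally show ?case
    by (simp del: newton.simps of_nat_Suc)
qed simp

definition falling :: "nat \<Rightarrow> rat poly" where
  "falling k = (\<Prod>i = 0..<k. [:- of_nat i, 1:])"

lemma newton_falling: "newton k (falling j) = (if k = j then 1 else 0)"
proof (induction j arbitrary: k)
  case 0
  show ?case by (cases k) (simp_all add: falling_def shift_poly_1 newton_diff[of _ 0 0, simplified])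
next
  case (Suc j)
  have "falling (Suc j) = pCons 0 (falling j) + smult (- of_nat j) (falling j)"
    by (simp add: falling_def algebra_simps)
  then show ?case
    by (cases k) (simp_all add: newton_add newton_smult newton_pCons Suc del: newton.simps smult_minus_left)
qed

lemma degree_falling: "degree (falling k) = k" and lead_coeff_falling: "lead_coeff (falling k) = 1"
proof -
  show "degree (falling k) = k"
    unfolding falling_def by (subst degree_prod_eq_sum_degree) auto
  show "lead_coeff (falling k) = 1"
    unfolding falling_def by (simp add: lead_coeff_prod)
qed

text \<open>An expansion exists because \<open>falling k\<close> is monic of degree k, so leading
  terms can be peeled off; by \<open>newton_falling\<close> its coefficients are the values of
  \<open>newton\<close>.\<close>

lemma newton_expansion:
  assumes "degree p \<le> n"
  shows "p = (\<Sum>k\<le>n. smult (newton k p) (falling k))"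
proof -
  have "\<exists>c. p = (\<Sum>k\<le>n. smult (c k) (falling k))"
    using assms
  proof (induction n arbitrary: p)
    case 0
    then have "p = (\<Sum>k\<le>0. smult (coeff p 0) (falling k))"
      by (simp add: falling_def) (metis degree_0_id)
    then show ?case by (intro exI[of _ "\<lambda>_. coeff p 0"])
  next
    case (Suc n)
    define q where "q = p - smult (coeff p (Suc n)) (falling (Suc n))"
    have "coeff q j = 0" if "j > n" for j
    proof (cases "j = Suc n")
      case True
      then show ?thesis
        using lead_coeff_falling[of "Suc n"] by (simp add: q_def degree_falling)
    next
      case False
      then show ?thesis
        using that Suc.prems by (simp add: q_def coeff_eq_0 degree_falling)
    qed
    then have "degree q \<le> n"
      by (intro degree_le) auto
    then obtain c where c: "q = (\<Sum>k\<le>n. smult (c k) (falling k))"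
      using Suc.IH by blast
    have "p = (\<Sum>k\<le>Suc n. smult ((c(Suc n := coeff p (Suc n))) k) (falling k))"
      using c by (simp add: q_def algebra_simps)
    then show ?case by blast
  qed
  then obtain c where c: "p = (\<Sum>k\<le>n. smult (c k) (falling k))"
    by blast
  have "newton k p = c k" if "k \<le> n" for k
    unfolding c using that by (simp add: newton_sum newton_smult newton_falling if_distrib cong: if_cong)
  then have "(\<Sum>k\<le>n. smult (newton k p) (falling k)) = (\<Sum>k\<le>n. smult (c k) (falling k))"
    by (intro sum.cong) auto
  with c show ?thesis by simp
qed

lemma newton_eq_0: "degree p < k \<Longrightarrow> newton k p = 0"
  by (subst newton_expansion[of p "degree p"]) (simp_all add: newton_sum newton_smult newton_falling)

section \<open>Coefficients in the binomial basis\<close>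

lemma gchoose_eq_to_fract: "X gchoose k = to_fract (smult (1 / fact k) (falling k))"
proof -
  have fact: "(fact k :: ratfun) = to_fract [:fact k:]"
    using of_nat_eq_to_fract[of "fact k"] by (simp add: of_nat_poly del: of_nat_fact) (simp add: of_nat_fact)
  have "X - of_nat i = to_fract [:- of_nat i, 1:]" for i
    by (simp add: X_eq_to_fract of_nat_eq_to_fract of_nat_poly flip: to_fract_diff)
  moreover have "to_fract (\<Prod>i = 0..<k. p i) = (\<Prod>i = 0..<k. to_fract (p i))" for p :: "nat \<Rightarrow> rat poly"
    by (induction k) simp_all
  ultimately have "fact k * (X gchoose k) = to_fract (falling k)"
    by (simp add: gbinomial_mult_fact falling_def)
  also have "\<dots> = fact k * to_fract (smult (1 / fact k) (falling k))"
    unfolding fact to_fract_mult[symmetric] by simp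
  finally show ?thesis by simp
qed

text \<open>The factorial converts falling factorials into binomial coefficients. Duality with
  \<open>falling\<close> gives the uniqueness that the definite description needs.\<close>

lemma b_eq_newton:
  assumes P: "P n = to_fract p" and deg: "degree p \<le> m n" and i: "i \<le> m n"
  shows "b i n = fact (m n - i) * newton (m n - i) p"
proof -
  let ?c = "\<lambda>j. if j \<le> m n then fact (m n - j) * newton (m n - j) p else 0"
  have iff: "P n = (\<Sum>j\<le>m n. of_rat (c j) * (X gchoose (m n - j)))
      \<longleftrightarrow> p = (\<Sum>j\<le>m n. smult (c j / fact (m n - j)) (falling (m n - j)))" for c
  proof -
    have "of_rat (c j) * (X gchoose (m n - j))
        = to_fract (smult (c j / fact (m n - j)) (falling (m n - j)))" for j
      by (simp add: of_rat_eq_to_fract gchoose_eq_to_fract flip: to_fract_mult)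
    then show ?thesis
      by (simp add: P flip: to_fract_sum)
  qed
  have "(THE c. P n = (\<Sum>j\<le>m n. of_rat (c j) * (X gchoose (m n - j))) \<and> (\<forall>j>m n. c j = 0)) = ?c"
    unfolding iff
  proof (rule the_equality)
    have "p = (\<Sum>k\<le>m n. smult (newton k p) (falling k))"
      by (rule newton_expansion[OF deg])
    also have "\<dots> = (\<Sum>j\<le>m n. smult (newton (m n - j) p) (falling (m n - j)))"
      by (rule sum.reindex_bij_witness[of _ "\<lambda>j. m n - j" "\<lambda>j. m n - j"]) auto
    finally show "p = (\<Sum>j\<le>m n. smult (?c j / fact (m n - j)) (falling (m n - j))) \<and> (\<forall>j>m n. ?c j = 0)"
      by simp
  next
    fix c :: "nat \<Rightarrow> rat"
    assume c: "p = (\<Sum>j\<le>m n. smult (c j / fact (m n - j)) (falling (m n - j))) \<and> (\<forall>j>m n. c j = 0)"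
    have "newton (m n - j) p = c j / fact (m n - j)" if "j \<le> m n" for j
    proof -
      have "newton (m n - j) p
          = (\<Sum>k\<le>m n. if m n - j = m n - k then c k / fact (m n - k) else 0)"
        using c by (subst conjunct1[OF c]) (simp add: newton_sum newton_smult newton_falling if_distrib cong: if_cong)
      also have "\<dots> = (\<Sum>k\<le>m n. if k = j then c k / fact (m n - k) else 0)"
        using that by (intro sum.cong) auto
      finally show ?thesis using that by simp
    qed
    then show "c = ?c"
      using c by (auto simp: fun_eq_iff)
  qed
  then show ?thesis
    using i by (simp add: b_def)
qed

subsection \<open>Recurrences for the coefficients\<close>

text \<open>Extension by zero respects multiplication by x and the shift: at k = -1 the shift rule
  has the factor k + 1 = 0 in front of the coefficient at index 0.\<close>

definition newton_int :: "int \<Rightarrow> rat poly \<Rightarrow> rat" where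
  "newton_int k p = (if k < 0 then 0 else newton (nat k) p)"

lemma newton_int_add: "newton_int k (p + q) = newton_int k p + newton_int k q"
  by (simp add: newton_int_def newton_add)

lemma newton_int_smult: "newton_int k (smult c p) = c * newton_int k p"
  by (simp add: newton_int_def newton_smult)

lemma newton_int_pCons: "newton_int k (pCons 0 p) = of_int k * newton_int k p + newton_int (k - 1) p"
  by (auto simp: newton_int_def newton_pCons nat_diff_distrib)

lemma newton_int_linear:
  "newton_int k ([:c, d:] * p) = (c + d * of_int k) * newton_int k p + d * newton_int (k - 1) p"
  by (simp add: newton_int_add newton_int_smult newton_int_pCons algebra_simps)

lemma newton_int_shift:
  "newton_int k (shift_poly p) = newton_int k p + (of_int k + 1) * newton_int (k + 1) p"
proof (cases "k < -1")
  case False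
  then consider "k = -1" | "k \<ge> 0" by linarith
  then show ?thesis
  proof cases
    case 2
    then show ?thesis
      using newton_shift_poly[of "nat k" p] by (simp add: newton_int_def nat_add_distrib del: newton.simps)
  qed (simp add: newton_int_def)
qed (simp add: newton_int_def)

lemma newton_int_eq_0: "int (degree p) < k \<Longrightarrow> newton_int k p = 0"
  by (simp add: newton_int_def newton_eq_0)

text \<open>Up to the factor \<open>fact (h - i)\<close>, \<open>odd_coeff i h\<close> and \<open>even_coeff i h\<close> are the coefficients
  \<open>b i (2 h + 1)\<close> and \<open>b i (2 h + 2)\<close>. Integer indices make the recurrences hold without
  boundary cases.\<close>

definition odd_coeff :: "int \<Rightarrow> nat \<Rightarrow> rat" where
  "odd_coeff i h = newton_int (int h - i) (P_odd h)"

definition even_coeff :: "int \<Rightarrow> nat \<Rightarrow> rat" where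
  "even_coeff i h = newton_int (int h - i) (P_even h)"

definition ell_coeff :: "int \<Rightarrow> nat \<Rightarrow> rat" where
  "ell_coeff i h = newton_int (int h - i) (ell_poly h)"

lemma coeff_neg:
  assumes "i < 0"
  shows "odd_coeff i h = 0" "even_coeff i h = 0" "ell_coeff i h = 0"
  unfolding odd_coeff_def even_coeff_def ell_coeff_def
  using assms degree_P_odd[of h] degree_P_even[of h] degree_ell_poly[of h]
  by (auto intro!: newton_int_eq_0)

lemma odd_coeff_0: "odd_coeff i 0 = (if i = 0 then 1 else 0)"
  and ell_coeff_0: "ell_coeff i 0 = (if i = 0 then 1 else 0)"
  using coeff_neg[of i 0] by (auto simp: odd_coeff_def ell_coeff_def newton_int_def)

lemma ell_coeff_Suc:
  "ell_coeff i (Suc h) = ell_coeff i h + (2 * of_nat h + 2 - of_int i) * ell_coeff (i - 1) h"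
  unfolding ell_coeff_def ell_poly_Suc newton_int_linear
  by (simp add: algebra_simps)

text \<open>Coefficients of index h + 1 - i in \<open>P_even_rec_poly\<close> are compared. The
  shift reaches up to index h + 2 - i and multiplication by x down to h - i, which accounts for i -
  2, i - 1 and i.\<close>

lemma even_coeff_eq:
  "8 * even_coeff i h = 4 * odd_coeff i h
     - (16 * of_nat h + 12 - 8 * of_int i) * even_coeff (i - 1) h
     + (12 * of_nat h + 9 - 6 * of_int i) * odd_coeff (i - 1) h
     + (4 * of_nat h + 3 - 2 * of_int i) * (of_nat h + 2 - of_int i) * odd_coeff (i - 2) h
     + 4 * ell_coeff i h + (6 * of_nat h + 5 - 4 * of_int i) * ell_coeff (i - 1) h"
proof -
  have "newton_int (int h + 1 - i) ([:8 * of_nat h + 4, 8:] * P_even h)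
     = newton_int (int h + 1 - i) ([:4 * of_nat h + 2, 2:] * P_odd h
       + [:2 * of_nat h + 1, 2:] * shift_poly (P_odd h) + [:2 * of_nat h + 1, 4:] * ell_poly h)"
    by (simp only: P_even_rec_poly)
  then show ?thesis
    unfolding newton_int_add newton_int_linear newton_int_shift
    by (simp add: odd_coeff_def even_coeff_def ell_coeff_def algebra_simps)
qed

lemma odd_coeff_Suc_even:
  "4 * odd_coeff i (Suc h) = 8 * even_coeff i h
     + (24 * of_nat h + 26 - 12 * of_int i) * even_coeff (i - 1) h
     + (8 * of_nat h + 10 - 4 * of_int i) * (of_nat h + 2 - of_int i) * even_coeff (i - 2) h
     + 4 * ell_coeff i h + (6 * of_nat h + 6 - 4 * of_int i) * ell_coeff (i - 1) h"
  unfolding odd_coeff_def P_odd.simps newton_int_smult newton_int_add newton_int_linear newton_int_shift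
  by (simp add: odd_coeff_def even_coeff_def ell_coeff_def algebra_simps)

text \<open>Eliminating \<open>even_coeff i h\<close> leaves \<open>4 * odd_coeff i h\<close>, which
  moves to the left. The right side then has only lower i besides \<open>ell_coeff\<close>, so the
  sequence can be found by summation over h.\<close>

lemma odd_coeff_Suc:
  "4 * (odd_coeff i (Suc h) - odd_coeff i h) =
     (8 * of_nat h + 14 - 4 * of_int i) * even_coeff (i - 1) h
     + (12 * of_nat h + 9 - 6 * of_int i) * odd_coeff (i - 1) h
     + (4 * of_nat h + 3 - 2 * of_int i) * (of_nat h + 2 - of_int i) * odd_coeff (i - 2) h
     + (8 * of_nat h + 10 - 4 * of_int i) * (of_nat h + 2 - of_int i) * even_coeff (i - 2) h
     + 8 * ell_coeff i h + (12 * of_nat h + 11 - 8 * of_int i) * ell_coeff (i - 1) h"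
  using odd_coeff_Suc_even[of i h] even_coeff_eq[of i h] by (simp add: algebra_simps)

section \<open>Explicit coefficients for i = 0 and i = 1\<close>

lemma coeffs_0: "ell_coeff 0 h = 1" "odd_coeff 0 h = 2 * of_nat h + 1" "even_coeff 0 h = of_nat h + 1"
proof -
  show e: "ell_coeff 0 h = 1" for h
    by (induction h) (simp_all add: ell_coeff_0 ell_coeff_Suc coeff_neg)
  show y: "odd_coeff 0 h = 2 * of_nat h + 1" for h
  proof (induction h)
    case (Suc h)
    then show ?case using odd_coeff_Suc[of 0 h] by (simp add: coeff_neg e)
  qed (simp add: odd_coeff_0)
  show "even_coeff 0 h = of_nat h + 1"
    using even_coeff_eq[of 0 h] by (simp add: coeff_neg e y)
qed

lemma coeffs_1:
  "ell_coeff 1 h = of_nat h ^ 2"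
  "odd_coeff 1 h = of_nat h * (2 * of_nat h + 1) * (5 * of_nat h - 1) / 3"
  "even_coeff 1 h = of_nat h * (of_nat h + 1) * (5 * of_nat h + 1) / 3"
proof -
  show e: "ell_coeff 1 h = of_nat h ^ 2" for h
    by (induction h) (simp_all add: ell_coeff_0 ell_coeff_Suc coeffs_0 power2_eq_square algebra_simps)
  show y: "odd_coeff 1 h = of_nat h * (2 * of_nat h + 1) * (5 * of_nat h - 1) / 3" for h
  proof (induction h)
    case (Suc h)
    have "4 * odd_coeff 1 (Suc h) = 4 * (odd_coeff 1 (Suc h) - odd_coeff 1 h) + 4 * odd_coeff 1 h"
      by simp
    also have "\<dots> = 4 * (of_nat (Suc h) * (2 * of_nat (Suc h) + 1) * (5 * of_nat (Suc h) - 1) / 3)"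
      unfolding odd_coeff_Suc unfolding Suc by (simp add: coeff_neg coeffs_0 e power2_eq_square field_simps)
    finally show ?case by simp
  qed (simp add: odd_coeff_0)
  have "8 * even_coeff 1 h = 8 * (of_nat h * (of_nat h + 1) * (5 * of_nat h + 1) / 3)"
    unfolding even_coeff_eq y e by (simp add: coeff_neg coeffs_0 power2_eq_square field_simps)
  then show "even_coeff 1 h = of_nat h * (of_nat h + 1) * (5 * of_nat h + 1) / 3"
    by simp
qed

lemma b_odd: "i \<le> h \<Longrightarrow> b i (2 * h + 1) = fact (h - i) * odd_coeff (int i) h"
  using b_eq_newton[of "2 * h + 1" "P_odd h" i] P_eq_to_fract[of h] degree_P_odd[of h]
  by (simp add: m_def odd_coeff_def newton_int_def nat_diff_distrib)

lemma b_even: "i \<le> h \<Longrightarrow> b i (2 * h + 2) = fact (h - i) * even_coeff (int i) h"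
  using b_eq_newton[of "2 * h + 2" "P_even h" i] P_eq_to_fract[of h] degree_P_even[of h]
  by (simp add: m_def even_coeff_def newton_int_def nat_diff_distrib)

section \<open>Polynomial dependence on h and exact degrees\<close>

text \<open>Induction on d: subtracting a suitable monomial from f lowers the degree bound on its
  difference. Bounds are stated through vanishing coefficients so that the top coefficient is
  tracked as well.\<close>

lemma polynomial_summation:
  fixes f :: "nat \<Rightarrow> rat"
  assumes "\<And>j. j \<ge> d \<Longrightarrow> coeff D j = 0"
    and "\<And>h. f (Suc h) - f h = poly D (of_nat h)"
  obtains F where "\<And>h. f h = poly F (of_nat h)" "\<And>j. j > d \<Longrightarrow> coeff F j = 0"
    "d > 0 \<Longrightarrow> of_nat d * coeff F d = coeff D (d - 1)"
proof -
  have "\<exists>F. (\<forall>h. f h = poly F (of_nat h)) \<and> (\<forall>j>d. coeff F j = 0)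
      \<and> (d > 0 \<longrightarrow> of_nat d * coeff F d = coeff D (d - 1))"
    using assms
  proof (induction d arbitrary: f D)
    case 0
    then have "D = 0" by (simp add: poly_eq_iff)
    then have "f (Suc h) = f h" for h
      using 0(2)[of h] by simp
    then have "f h = f 0" for h
      by (induction h) simp_all
    then have "f h = poly [:f 0:] (of_nat h)" for h
      by simp
    moreover have "coeff [:f 0:] j = 0" if "j > 0" for j
      using that by (simp add: coeff_pCons split: nat.split)
    ultimately show ?case by blast
  next
    case (Suc d)
    \<comment> \<open>The difference of c x^(d+1) has leading term c (d + 1) x^d, which is to match
      the top term of \<open>D\<close>.\<close>
    define c where "c = coeff D d / of_nat (Suc d)"
    define M where "M = monom c (Suc d)"
    have shift_M: "shift_poly M = smult c ([:1, 1:] ^ Suc d)"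
      unfolding M_def
      by (rule poly_ext) (simp add: poly_pcompose poly_monom poly_power algebra_simps)
    have coeff_shift_M: "coeff (shift_poly M) j = c * of_nat (Suc d choose j)" if "j \<le> Suc d" for j
      unfolding shift_M coeff_smult coeff_linear_poly_power[OF that] by simp
    have deg_M: "degree M \<le> Suc d"
      unfolding M_def by (rule degree_monom_le)
    obtain F where F: "\<forall>h. f h - poly M (of_nat h) = poly F (of_nat h)" "\<forall>j>d. coeff F j = 0"
    proof -
      have vanish: "coeff (D - (shift_poly M - M)) j = 0" if j: "j \<ge> d" for j
      proof -
        consider "j = d" | "j = Suc d" | "j > Suc d" using j by linarith
        then show ?thesis
        proof cases
          case 1
          have "coeff (shift_poly M) d = coeff D d"
            using coeff_shift_M[of d] by (simp add: c_def del: of_nat_Suc)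
          then show ?thesis
            using 1 by (simp add: M_def)
        next
          case 2
          have "coeff (shift_poly M) (Suc d) = c" "coeff D (Suc d) = 0"
            using coeff_shift_M[of "Suc d"] Suc.prems(1)[of "Suc d"] by simp_all
          then show ?thesis
            using 2 by (simp add: M_def)
        next
          case 3
          then have "coeff (shift_poly M) j = 0" "coeff M j = 0" "coeff D j = 0"
            using Suc.prems(1)[of j] deg_M by (simp_all add: coeff_eq_0 degree_shift_poly)
          then show ?thesis by simp
        qed
      qed
      have diff: "(f (Suc h) - poly M (of_nat (Suc h))) - (f h - poly M (of_nat h))
          = poly (D - (shift_poly M - M)) (of_nat h)" for h
        using Suc.prems(2)[of h] by (simp add: poly_pcompose algebra_simps)
      show ?thesis
        using Suc.IH[OF vanish diff] by (auto intro: that)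
    qed
    have "f h = poly (F + M) (of_nat h)" for h
      using F(1)[rule_format, of h] by simp
    moreover have "coeff (F + M) j = 0" if "j > Suc d" for j
      using F(2) that by (simp add: M_def)
    moreover have "of_nat (Suc d) * coeff (F + M) (Suc d) = coeff D d"
      using F(2) by (simp add: M_def c_def del: of_nat_Suc)
    ultimately show ?case
      by (intro exI[of _ "F + M"]) (simp del: of_nat_Suc)
  qed
  then show ?thesis using that by blast
qed

lemma coeff_linear_mult: "coeff ([:c, d:] * p) (Suc j) = c * coeff p (Suc j) + d * coeff p j"
  for p :: "rat poly"
  by simp

text \<open>The bound is strict, so d = 0 means the zero polynomial; this covers the index -1
  below.\<close>

definition poly_family :: "(nat \<Rightarrow> rat) \<Rightarrow> rat poly \<Rightarrow> nat \<Rightarrow> bool" where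
  "poly_family f p d \<longleftrightarrow> (\<forall>h. f h = poly p (of_nat h)) \<and> (\<forall>j\<ge>d. coeff p j = 0)"

text \<open>The recurrences reach back two indices, so two consecutive ones are carried along. The
  relation between the leading coefficients of \<open>Y\<close> and \<open>Z\<close> and their
  positivity exclude cancellation at the next index.\<close>

lemma coeffs_polynomial:
  "(\<exists>Y Z. poly_family (odd_coeff (int i - 1)) Y (2 * i) \<and> poly_family (even_coeff (int i - 1)) Z (2 * i))
   \<and> (\<exists>Y Z E. poly_family (odd_coeff (int i)) Y (2 * i + 2) \<and> poly_family (even_coeff (int i)) Z (2 * i + 2)
       \<and> poly_family (ell_coeff (int i)) E (2 * i + 1)
       \<and> coeff Y (2 * i + 1) > 0 \<and> coeff Z (2 * i + 1) = coeff Y (2 * i + 1) / 2 \<and> coeff E (2 * i) > 0)"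
proof (induction i)
  case 0
  have "poly_family (odd_coeff 0) [:1, 2:] (Suc (Suc 0))" "poly_family (even_coeff 0) [:1, 1:] (Suc (Suc 0))"
    "poly_family (ell_coeff 0) 1 (Suc 0)"
    by (auto simp: poly_family_def coeffs_0 coeff_pCons split: nat.split)
  then have "\<exists>Y Z E. poly_family (odd_coeff (int 0)) Y (2 * 0 + 2)
      \<and> poly_family (even_coeff (int 0)) Z (2 * 0 + 2) \<and> poly_family (ell_coeff (int 0)) E (2 * 0 + 1)
      \<and> coeff Y (2 * 0 + 1) > 0 \<and> coeff Z (2 * 0 + 1) = coeff Y (2 * 0 + 1) / 2 \<and> coeff E (2 * 0) > 0"
    by - (rule exI[of _ "[:1, 2:]"], rule exI[of _ "[:1, 1:]"], rule exI[of _ 1], simp)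
  moreover have "poly_family (odd_coeff (int 0 - 1)) 0 (2 * 0)" "poly_family (even_coeff (int 0 - 1)) 0 (2 * 0)"
    by (auto simp: poly_family_def coeff_neg)
  ultimately show ?case by blast
next
  case (Suc i)
  from Suc obtain Y0 Z0 where Y0: "poly_family (odd_coeff (int i - 1)) Y0 (2 * i)"
    and Z0: "poly_family (even_coeff (int i - 1)) Z0 (2 * i)"
    by blast
  from Suc obtain Y1 Z1 E1 where Y1: "poly_family (odd_coeff (int i)) Y1 (2 * i + 2)"
    and Z1: "poly_family (even_coeff (int i)) Z1 (2 * i + 2)"
    and E1: "poly_family (ell_coeff (int i)) E1 (2 * i + 1)"
    and lead: "coeff Y1 (2 * i + 1) > 0" "coeff Z1 (2 * i + 1) = coeff Y1 (2 * i + 1) / 2"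
      "coeff E1 (2 * i) > 0"
    by blast
  let ?i = "of_nat i :: rat"
  have vals: "odd_coeff (int i - 1) h = poly Y0 (of_nat h)" "even_coeff (int i - 1) h = poly Z0 (of_nat h)"
    "odd_coeff (int i) h = poly Y1 (of_nat h)" "even_coeff (int i) h = poly Z1 (of_nat h)"
    "ell_coeff (int i) h = poly E1 (of_nat h)" for h
    using Y0 Z0 Y1 Z1 E1 by (simp_all add: poly_family_def)
  have van: "j \<ge> 2 * i \<Longrightarrow> coeff Y0 j = 0" "j \<ge> 2 * i \<Longrightarrow> coeff Z0 j = 0"
    "j \<ge> 2 * i + 2 \<Longrightarrow> coeff Y1 j = 0" "j \<ge> 2 * i + 2 \<Longrightarrow> coeff Z1 j = 0"
    "j \<ge> 2 * i + 1 \<Longrightarrow> coeff E1 j = 0" for j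
    using Y0 Z0 Y1 Z1 E1 by (simp_all add: poly_family_def)

  \<comment> \<open>The increment of \<open>ell_coeff\<close> at i + 1; its top coefficient is twice
    that of \<open>E1\<close>.\<close>
  define DE where "DE = [:1 - ?i, 2:] * E1"
  have "coeff DE j = 0" if "j \<ge> 2 * i + 2" for j
    using that by (cases j) (simp_all only: DE_def coeff_linear_mult, simp_all add: van)
  moreover have "ell_coeff (int (Suc i)) (Suc h) - ell_coeff (int (Suc i)) h = poly DE (of_nat h)" for h
    using ell_coeff_Suc[of "int (Suc i)" h] by (simp add: DE_def vals algebra_simps)
  ultimately obtain E where E: "\<And>h. ell_coeff (int (Suc i)) h = poly E (of_nat h)"
      "\<And>j. j > 2 * i + 2 \<Longrightarrow> coeff E j = 0"
    and E_lead: "of_nat (2 * i + 2) * coeff E (2 * i + 2) = coeff DE (2 * i + 1)"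
    by (rule polynomial_summation) auto
  have "coeff DE (2 * i + 1) > 0"
    using lead(3) by (simp add: DE_def van)
  then have E_pos: "coeff E (2 * i + 2) > 0"
    unfolding E_lead[symmetric] by (simp add: zero_less_mult_iff del: of_nat_add of_nat_mult)

  define DY where "DY = smult (1/4) ([:10 - 4 * ?i, 8:] * Z1 + [:3 - 6 * ?i, 12:] * Y1
    + [:1 - 2 * ?i, 4:] * ([:1 - ?i, 1:] * Y0) + [:6 - 4 * ?i, 8:] * ([:1 - ?i, 1:] * Z0)
    + smult 8 E + [:3 - 8 * ?i, 12:] * E1)"
  have "coeff DY j = 0" if j: "j \<ge> 2 * i + 3" for j
  proof -
    obtain l where "j = Suc (Suc l)" "l \<ge> 2 * i + 1"
      using j by (intro that[of "j - 2"]) auto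
    then show ?thesis
      by (simp only: DY_def coeff_linear_mult coeff_smult coeff_add) (simp add: van E)
  qed
  moreover have "odd_coeff (int (Suc i)) (Suc h) - odd_coeff (int (Suc i)) h = poly DY (of_nat h)" for h
    using odd_coeff_Suc[of "int (Suc i)" h] E(1)[of h] by (simp add: DY_def vals field_simps)
  ultimately obtain Y where Y: "\<And>h. odd_coeff (int (Suc i)) h = poly Y (of_nat h)"
      "\<And>j. j > 2 * i + 3 \<Longrightarrow> coeff Y j = 0"
    and Y_lead: "of_nat (2 * i + 3) * coeff Y (2 * i + 3) = coeff DY (2 * i + 2)"
    by (rule polynomial_summation) auto
  \<comment> \<open>Only \<open>Z1\<close>, \<open>Y1\<close> and \<open>E\<close> reach this
    degree: the contribution is 2 \<open>Z1\<close> + 3 \<open>Y1\<close> + 2 \<open>E\<close>, and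
    the top coefficient of \<open>Z1\<close> is half that of \<open>Y1\<close>.\<close>
  have "coeff DY (2 * i + 2) = 4 * coeff Y1 (2 * i + 1) + 2 * coeff E (2 * i + 2)"
    using lead(2) by (simp add: DY_def van)
  then have "coeff DY (2 * i + 2) > 0"
    using lead(1) E_pos by simp
  then have Y_pos: "coeff Y (2 * i + 3) > 0"
    unfolding Y_lead[symmetric] by (simp add: zero_less_mult_iff del: of_nat_add of_nat_mult)

  define Z where "Z = smult (1/8) (smult 4 Y + [:8 * ?i - 4, -16:] * Z1 + [:3 - 6 * ?i, 12:] * Y1
    + [:1 - 2 * ?i, 4:] * ([:1 - ?i, 1:] * Y0) + smult 4 E + [:1 - 4 * ?i, 6:] * E1)"
  have Z: "even_coeff (int (Suc i)) h = poly Z (of_nat h)" for h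
    using even_coeff_eq[of "int (Suc i)" h] E(1)[of h] Y(1)[of h] by (simp add: Z_def vals field_simps)
  \<comment> \<open>All terms of \<open>Z\<close> other than \<open>Y\<close> have degree at most 2
    i + 2, so the factor 4/8 is what remains.\<close>
  have coeff_Z: "coeff Z j = coeff Y j / 2" if j: "j \<ge> 2 * i + 3" for j
  proof -
    obtain l where "j = Suc (Suc l)" "l \<ge> 2 * i + 1"
      using j by (intro that[of "j - 2"]) auto
    then show ?thesis
      by (simp only: Z_def coeff_linear_mult coeff_smult coeff_add) (simp add: van E)
  qed

  have "poly_family (odd_coeff (int (Suc i) - 1)) Y1 (2 * Suc i)"
    "poly_family (even_coeff (int (Suc i) - 1)) Z1 (2 * Suc i)"
    using Y1 Z1 by simp_all
  moreover have "poly_family (odd_coeff (int (Suc i))) Y (2 * Suc i + 2)"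
    "poly_family (even_coeff (int (Suc i))) Z (2 * Suc i + 2)"
    "poly_family (ell_coeff (int (Suc i))) E (2 * Suc i + 1)"
    by (simp_all only: poly_family_def) (auto simp: Y Z E coeff_Z simp del: of_nat_Suc)
  moreover have "coeff Y (2 * Suc i + 1) > 0" "coeff Z (2 * Suc i + 1) = coeff Y (2 * Suc i + 1) / 2"
    "coeff E (2 * Suc i) > 0"
    using Y_pos E_pos coeff_Z[of "2 * i + 3"] by (simp_all add: eval_nat_numeral)
  ultimately show ?case by blast
qed

lemma coeffs_polynomial_degree:
  obtains Y Z :: "rat poly" where "degree Y = 2 * i + 1" "degree Z = 2 * i + 1"
    "\<And>h. odd_coeff (int i) h = poly Y (of_nat h)" "\<And>h. even_coeff (int i) h = poly Z (of_nat h)"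
proof -
  from coeffs_polynomial[of i] obtain Y Z where
    "poly_family (odd_coeff (int i)) Y (2 * i + 2)" "poly_family (even_coeff (int i)) Z (2 * i + 2)"
    and "coeff Y (2 * i + 1) > 0" "coeff Z (2 * i + 1) = coeff Y (2 * i + 1) / 2"
    by blast
  then show ?thesis
    by (intro that[of Y Z] antisym degree_le le_degree) (auto simp: poly_family_def)
qed

theorem theorem8:
  shows "(\<forall>n\<ge>1. b 0 n =
            (if odd n then of_nat n * fact ((n - 1) div 2) else fact (n div 2)))
       \<and> (\<forall>n\<ge>3. b 1 n =
            (if odd n then 1 / 6 * of_nat n * (5 * of_nat n - 7) * fact ((n - 1) div 2)
             else 1 / 6 * (5 * of_nat n - 8) * fact (n div 2)))
       \<and> (\<forall>i. \<exists>Y Z :: rat poly. degree Y = 2 * i + 1 \<and> degree Z = 2 * i + 1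
            \<and> (\<forall>n\<ge>1. odd n \<and> i \<le> m n \<longrightarrow> b i n = fact (m n - i) * poly Y (of_nat n))
            \<and> (\<forall>n\<ge>1. even n \<and> i \<le> m n \<longrightarrow> b i n = fact (m n - i) * poly Z (of_nat n)))"
proof (intro conjI allI impI)
  have even_form: "\<exists>h. n = 2 * h + 2" if "n \<ge> 1" "even n" for n :: nat
    using that by (intro exI[of _ "n div 2 - 1"]) (auto elim!: evenE)
  fix n :: nat
  show "b 0 n = (if odd n then of_nat n * fact ((n - 1) div 2) else fact (n div 2))" if "n \<ge> 1"
  proof (cases "odd n")
    case True
    then obtain h where "n = 2 * h + 1" by (elim oddE)
    then show ?thesis using b_odd[of 0 h] by (simp add: coeffs_0)
  next
    case False
    with that even_form obtain h where "n = 2 * h + 2" by blast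
    then show ?thesis using b_even[of 0 h] by (simp add: coeffs_0 algebra_simps)
  qed
  show "b 1 n = (if odd n then 1 / 6 * of_nat n * (5 * of_nat n - 7) * fact ((n - 1) div 2)
             else 1 / 6 * (5 * of_nat n - 8) * fact (n div 2))" if "n \<ge> 3"
  proof (cases "odd n")
    case True
    then obtain h where n: "n = 2 * h + 1" by (elim oddE)
    \<comment> \<open>As h >= 1, the factor h in \<open>coeffs_1\<close> combines with
      \<open>fact (h - 1)\<close> to \<open>fact h\<close>.\<close>
    with that obtain l where "h = Suc l" by (cases h) auto
    with n show ?thesis using b_odd[of 1 h] by (simp add: coeffs_1 field_simps)
  next
    case False
    with that even_form obtain h where n: "n = 2 * h + 2" by (metis One_nat_def le_trans one_le_numeral)
    with that obtain l where "h = Suc l" by (cases h) auto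
    with n show ?thesis using b_even[of 1 h] by (simp add: coeffs_1 field_simps)
  qed
next
  have even_form: "\<exists>h. n = 2 * h + 2" if "n \<ge> 1" "even n" for n :: nat
    using that by (intro exI[of _ "n div 2 - 1"]) (auto elim!: evenE)
  fix i :: nat
  obtain Y Z :: "rat poly" where deg: "degree Y = 2 * i + 1" "degree Z = 2 * i + 1"
    and vals: "\<And>h. odd_coeff (int i) h = poly Y (of_nat h)" "\<And>h. even_coeff (int i) h = poly Z (of_nat h)"
    using coeffs_polynomial_degree[of i] by blast
  \<comment> \<open>The substitutions h = (n - 1)/2 and h = n/2 - 1; being linear and nonconstant,
    they preserve the degree.\<close>
  let ?Y = "pcompose Y [:-1/2, 1/2:]" and ?Z = "pcompose Z [:-1, 1/2:]"
  have odd: "b i n = fact (m n - i) * poly ?Y (of_nat n)" if "odd n \<and> i \<le> m n" for n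
  proof -
    from that obtain h where n: "n = 2 * h + 1" by (auto elim!: oddE)
    then show ?thesis
      using that b_odd[of i h] by (simp add: m_def vals poly_pcompose add_divide_distrib)
  qed
  have even: "b i n = fact (m n - i) * poly ?Z (of_nat n)" if "n \<ge> 1" "even n \<and> i \<le> m n" for n
  proof -
    from that even_form obtain h where n: "n = 2 * h + 2" by blast
    then show ?thesis
      using that b_even[of i h] by (simp add: m_def vals poly_pcompose add_divide_distrib)
  qed
  show "\<exists>Y Z :: rat poly. degree Y = 2 * i + 1 \<and> degree Z = 2 * i + 1
            \<and> (\<forall>n\<ge>1. odd n \<and> i \<le> m n \<longrightarrow> b i n = fact (m n - i) * poly Y (of_nat n))
            \<and> (\<forall>n\<ge>1. even n \<and> i \<le> m n \<longrightarrow> b i n = fact (m n - i) * poly Z (of_nat n))"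
    by (rule exI[of _ ?Y], rule exI[of _ ?Z]) (use odd even in \<open>simp add: deg degree_pcompose\<close>)
qed

end
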